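(* Let $m\ge6$ be even, $h=\frac m2$, $f_7(x)=x+x^{2^{h+1}-1}+x^{2^m-2^{h+1}+2}\in\mathbb{F}_{2^m}[x]$, and let $s^\infty$ be the sequence $s_t=\operatorname{Tr}(f_7(\alpha^t+1))$, $t\ge0$. Then the minimal polynomial of $s^\infty$ (generator polynomial of $\mathcal{C}_s$) is $$g_s(x)=\prod_{i\in\Gamma_{(h)}\setminus\Gamma_{(h-1)}}m_{\alpha^{-(i+2^{h})}}(x)\prod_{j=1}^{h-2}\prod_{i\in\Gamma_{(j)}}m_{\alpha^{-(i+2^{j+1})}}(x),$$ the linear span of $s^\infty$ equals $m(2^{(m-2)/2}-1)$, and $\mathcal{C}_s$ has parameters $[2^m-1,\,2^m-1-m(2^{(m-2)/2}-1),\,d(\mathcal{C}_s)]$ with $2^{(m-4)/2}+1\le d(\mathcal{C}_s)\le 1+m(2^{(m-2)/2}-1)$.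
   Context: Let $v=2^m-1$, $\alpha$ a primitive element of $\mathbb{F}_{2^m}$, and $\operatorname{Tr}(x)=\sum_{i=0}^{m-1}x^{2^i}$ the absolute trace from $\mathbb{F}_{2^m}$ to $\mathbb{F}_2$. For a polynomial $F$ over $\mathbb{F}_{2^m}$ the binary sequence $s^\infty=(s_t)_{t\ge0}$ is defined by $s_t=\operatorname{Tr}(F(\alpha^t+1))$; it is periodic with period dividing $v$. Its minimal polynomial $g_s(x)$ is the polynomial $1+c_1x+\dots+c_Lx^L\in\mathbb{F}_2[x]$ of least degree $L$ such that $s_i+c_1s_{i-1}+\dots+c_Ls_{i-L}=0$ for all $i\ge L$; its degree $L_s$ is the linear span of $s^\infty$. $\mathcal{C}_s$ denotes the binary cyclic code of length $v$ with generator polynomial $g_s(x)$. For an integer $i$, $m_{\alpha^i}(x)$ is the minimal polynomial of $\alpha^i$ over $\mathbb{F}_2$. For a positive integer $t$, $\Gamma_{(t)}=\{j:1\le j\le 2^t-1,\ j\text{ odd}\}$. $d(\mathcal{C})$ denotes minimum Hamming distance. *)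

theory Defs
  imports "HOL-Computational_Algebra.Polynomial"
begin

text \<open>The field F_{2^m} is modelled by a finite field type 'a with CARD('a) = 2^m;
  the prime field F_2 is the subset {0,1} of 'a.\<close>

definition binary :: "'a::field \<Rightarrow> bool" where
  "binary x \<longleftrightarrow> x = 0 \<or> x = 1"

definition binary_poly :: "'a::field poly \<Rightarrow> bool" where
  "binary_poly p \<longleftrightarrow> (\<forall>i. binary (coeff p i))"

definition trace :: "nat \<Rightarrow> 'a::field \<Rightarrow> 'a" where
  "trace m x = (\<Sum>i<m. x ^ (2 ^ i))"

definition primitive :: "'a::{finite,field} \<Rightarrow> bool" where
  "primitive a \<longleftrightarrow> a \<noteq> 0 \<and> (\<forall>x. x \<noteq> 0 \<longrightarrow> (\<exists>k::nat. x = a ^ k))"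

definition is_min_poly_F2 :: "'a::field \<Rightarrow> 'a poly \<Rightarrow> bool" where
  "is_min_poly_F2 b p \<longleftrightarrow> lead_coeff p = 1 \<and> binary_poly p \<and> poly p b = 0 \<and>
     (\<forall>q. q \<noteq> 0 \<and> binary_poly q \<and> poly q b = 0 \<longrightarrow> degree p \<le> degree q)"

definition min_poly_F2 :: "'a::field \<Rightarrow> 'a poly" where
  "min_poly_F2 b = (THE p. is_min_poly_F2 b p)"

definition lin_rec :: "'a::field poly \<Rightarrow> (nat \<Rightarrow> 'a) \<Rightarrow> bool" where
  "lin_rec p s \<longleftrightarrow> (\<forall>i\<ge>degree p. (\<Sum>k\<le>degree p. coeff p k * s (i - k)) = 0)"

definition is_seq_min_poly :: "(nat \<Rightarrow> 'a::field) \<Rightarrow> 'a poly \<Rightarrow> bool" where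
  "is_seq_min_poly s g \<longleftrightarrow> coeff g 0 = 1 \<and> binary_poly g \<and> lin_rec g s \<and>
     (\<forall>q. coeff q 0 = 1 \<and> binary_poly q \<and> lin_rec q s \<longrightarrow> degree g \<le> degree q)"

definition seq_min_poly :: "(nat \<Rightarrow> 'a::field) \<Rightarrow> 'a poly" where
  "seq_min_poly s = (THE g. is_seq_min_poly s g)"

definition linear_span :: "(nat \<Rightarrow> 'a::field) \<Rightarrow> nat" where
  "linear_span s = degree (seq_min_poly s)"

text \<open>Binary cyclic code of length v generated by g: the ideal generated by g in
  F_2[x]/(x^v - 1); codewords are represented by binary polynomials of degree < v.\<close>
definition cyclic_code :: "nat \<Rightarrow> 'a::field poly \<Rightarrow> 'a poly set" where
  "cyclic_code v g = {(a * g) mod (monom 1 v - 1) | a. binary_poly a}"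

definition hamming_dist :: "nat \<Rightarrow> 'a::field poly \<Rightarrow> 'a poly \<Rightarrow> nat" where
  "hamming_dist v c c' = card {i. i < v \<and> coeff c i \<noteq> coeff c' i}"

definition min_dist :: "nat \<Rightarrow> 'a::field poly set \<Rightarrow> nat" where
  "min_dist v C = Min {hamming_dist v c c' | c c'. c \<in> C \<and> c' \<in> C \<and> c \<noteq> c'}"

definition Gamma :: "nat \<Rightarrow> nat set" where
  "Gamma t = {j. 1 \<le> j \<and> j \<le> 2 ^ t - 1 \<and> odd j}"

definition f7 :: "nat \<Rightarrow> 'a::field \<Rightarrow> 'a" where
  "f7 m x = x + x ^ (2 ^ (m div 2 + 1) - 1) + x ^ (2 ^ m - 2 ^ (m div 2 + 1) + 2)"

end

theory Submission
  imports Defs "HOL-Number_Theory.Residues" "HOL-Library.Disjoint_Sets"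
begin

hide_const (open) UnivPoly.coeff UnivPoly.monom

text \<open>
  Write \<open>T(n) = Tr(x^n)\<close>, so \<open>T(2n) = T(n)\<close>. In characteristic two
  \<open>(x + 1)^(2^k - 1)\<close> is the sum of all \<open>x^i\<close> with \<open>i < 2^k\<close>; expanding the two high powers in
  \<open>f7 (x + 1)\<close> this way and cancelling equal terms leaves \<open>T(1)\<close> plus the sum of \<open>T\<close> over
  \<open>[2^(h-1), 2^h)\<close> and over \<open>[3 * 2^(h-1), 2^(h+1))\<close>. Replacing each exponent by its odd part, the
  numbers with leading bits 11 and at most \<open>h\<close> bits cancel, as does \<open>T(1)\<close>. The surviving odd
  exponents lie in pairwise distinct cyclotomic cosets of full size \<open>m\<close>, so the sequence is a sum of
  distinct geometric progressions, and a Vandermonde argument shows that its minimal polynomial is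
  the product of the corresponding linear factors. The odd exponents in
  \<open>[3 * 2^(h-1), 2^(h+1))\<close> form an arithmetic progression of \<open>2^(h-2)\<close> zeros of the code with
  difference 2, which is coprime to the length, so the BCH bound gives the lower bound on the
  distance. The upper bound comes from the weight of the generator polynomial.
\<close>

subsection \<open>Polynomials with prescribed simple roots\<close>

definition root_poly :: "'a::idom set \<Rightarrow> 'a poly" where
  "root_poly R = (\<Prod>r\<in>R. [:- r, 1:])"

lemma degree_root_poly: "degree (root_poly R) = card R"
  unfolding root_poly_def by (subst degree_prod_eq_sum_degree) auto

lemma lead_coeff_root_poly: "lead_coeff (root_poly R) = 1"
  unfolding root_poly_def by (simp add: lead_coeff_prod)

lemma root_poly_nonzero: "root_poly R \<noteq> 0"
  using lead_coeff_root_poly[of R] by force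

lemma poly_root_poly_eq_0_iff: "finite R \<Longrightarrow> poly (root_poly R) x = 0 \<longleftrightarrow> x \<in> R"
  unfolding root_poly_def by (auto simp: poly_prod)

lemma root_poly_dvd_iff:
  assumes "finite R"
  shows "root_poly R dvd q \<longleftrightarrow> (\<forall>r\<in>R. poly q r = 0)"
proof
  assume "root_poly R dvd q"
  then show "\<forall>r\<in>R. poly q r = 0"
    using assms by (auto elim!: dvdE simp: poly_root_poly_eq_0_iff)
next
  assume "\<forall>r\<in>R. poly q r = 0"
  with assms show "root_poly R dvd q"
  proof (induction R arbitrary: q rule: finite_induct)
    case empty
    show ?case by (simp add: root_poly_def)
  next
    case (insert a R)
    then obtain u where q_eq: "q = [:- a, 1:] * u"
      by (auto simp: poly_eq_0_iff_dvd)
    have "\<forall>r\<in>R. poly u r = 0" using insert.prems insert.hyps(2) unfolding q_eq by auto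
    then have "root_poly R dvd u" by (rule insert.IH)
    then show ?case
      using insert.hyps unfolding q_eq root_poly_def
      by (simp add: mult_dvd_mono del: mult_pCons_left)
  qed
qed

lemma root_poly_UNION:
  assumes "finite I" "\<And>i. i \<in> I \<Longrightarrow> finite (A i)" "disjoint_family_on A I"
  shows "root_poly (\<Union>i\<in>I. A i) = (\<Prod>i\<in>I. root_poly (A i))"
  unfolding root_poly_def
  using assms by (intro prod.UNION_disjoint) (auto simp: disjoint_family_on_def)

lemma monic_dvd_imp_eq:
  fixes p q :: "'a::idom poly"
  assumes "p dvd q" "lead_coeff p = 1" "lead_coeff q = 1" "degree q \<le> degree p"
  shows "q = p"
proof -
  obtain u where q_eq: "q = p * u" using assms(1) by blast
  then have "p \<noteq> 0" "u \<noteq> 0" using assms(2,3) by auto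
  then have "degree u = 0" using assms(4) q_eq by (simp add: degree_mult_eq)
  then obtain c where u_eq: "u = [:c:]" by (rule degree_eq_zeroE)
  have "lead_coeff u = 1" using assms(2,3) unfolding q_eq by (simp add: lead_coeff_mult)
  then show ?thesis using q_eq u_eq by (simp add: one_pCons[symmetric])
qed

lemma power_sums_eq_0_imp_coeff_eq_0:
  fixes x c :: "'b \<Rightarrow> 'a::idom"
  assumes fin: "finite S" and card_le: "card S \<le> N" and inj: "inj_on x S"
    and power_sums: "\<And>k. k < N \<Longrightarrow> (\<Sum>i\<in>S. c i * x i ^ k) = 0" and mem: "i \<in> S"
  shows "c i = 0"
proof -
  define p where "p = root_poly (x ` (S - {i}))"
  have "degree p = card S - 1"
    using fin mem inj by (simp add: p_def degree_root_poly card_image inj_on_diff)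
  moreover have "card S > 0" using fin mem card_gt_0_iff by blast
  ultimately have "degree p < N" using card_le by simp
  have "(\<Sum>j\<in>S. c j * poly p (x j)) = (\<Sum>k\<le>degree p. coeff p k * (\<Sum>j\<in>S. c j * x j ^ k))"
    unfolding poly_altdef sum_distrib_left by (subst sum.swap) (simp add: algebra_simps)
  also have "\<dots> = 0" using power_sums \<open>degree p < N\<close> by (intro sum.neutral) auto
  finally have "(\<Sum>j\<in>S. c j * poly p (x j)) = 0" .
  moreover have "poly p (x j) = 0 \<longleftrightarrow> j \<noteq> i" if "j \<in> S" for j
    using that fin mem inj by (auto simp: p_def poly_root_poly_eq_0_iff inj_on_def)
  ultimately show ?thesis using fin mem by (simp add: sum.remove[of S i] sum.neutral)
qed

subsection \<open>Binary polynomials in characteristic two\<close>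

context
  assumes char_2: "CHAR('a::field) = 2"
begin

lemma power2_eq_iff_CHAR_2: "x\<^sup>2 = y\<^sup>2 \<longleftrightarrow> x = (y::'a)"
  by (simp add: power2_eq_iff uminus_CHAR_2[OF char_2])

lemma binary_poly_iff_power2: "binary_poly (p::'a poly) \<longleftrightarrow> p\<^sup>2 = p \<circ>\<^sub>p monom 1 2"
proof -
  have binary: "binary c \<longleftrightarrow> c\<^sup>2 = c" for c :: 'a
    by (auto simp: binary_def power2_eq_square)
  have "p\<^sup>2 = (\<Sum>i\<le>degree p. monom (coeff p i) i)\<^sup>2"
    by (simp add: poly_as_sum_of_monoms)
  also have "\<dots> = (\<Sum>i\<le>degree p. monom ((coeff p i)\<^sup>2) (2 * i))"
    using char_2 by (simp add: freshmans_dream_sum monom_power mult.commute)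
  finally have square: "p\<^sup>2 = (\<Sum>i\<le>degree p. monom ((coeff p i)\<^sup>2) (2 * i))" .
  have "p \<circ>\<^sub>p monom 1 2 = (\<Sum>i\<le>degree p. monom (coeff p i) i) \<circ>\<^sub>p monom 1 2"
    by (simp add: poly_as_sum_of_monoms)
  also have "\<dots> = (\<Sum>i\<le>degree p. monom (coeff p i) (2 * i))"
    unfolding pcompose_sum
    by (simp add: pcompose_altdef map_poly_monom poly_monom monom_power smult_monom)
  finally have compose: "p \<circ>\<^sub>p monom 1 2 = (\<Sum>i\<le>degree p. monom (coeff p i) (2 * i))" .
  show ?thesis
  proof
    assume "binary_poly p"
    then show "p\<^sup>2 = p \<circ>\<^sub>p monom 1 2"
      unfolding square compose by (simp add: binary_poly_def binary)
  next
    assume eq: "p\<^sup>2 = p \<circ>\<^sub>p monom 1 2"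
    have "(coeff p n)\<^sup>2 = coeff p n" for n
    proof (cases "n \<le> degree p")
      case True
      then show ?thesis
        using arg_cong[OF eq, of "\<lambda>p. coeff p (2 * n)"] unfolding square compose
        by (simp add: coeff_sum)
    qed (simp add: coeff_eq_0)
    then show "binary_poly p" by (simp add: binary_poly_def binary)
  qed
qed

lemma binary_root_poly:
  assumes "finite R" "\<And>r. r \<in> R \<Longrightarrow> r\<^sup>2 \<in> (R::'a set)"
  shows "binary_poly (root_poly R)"
proof -
  have inj: "inj_on (\<lambda>r. r\<^sup>2) R" by (simp add: inj_on_def power2_eq_iff_CHAR_2)
  then have image: "(\<lambda>r. r\<^sup>2) ` R = R" using assms by (intro endo_inj_surj) auto
  have linear: "[:- r, 1:]\<^sup>2 = [:- r\<^sup>2, 1:] \<circ>\<^sub>p monom 1 2" for r :: 'a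
    by (simp add: power2_eq_square pcompose_pCons uminus_CHAR_2[OF char_2] monom_altdef
        minus_CHAR_2[OF char_2, symmetric])
  have "(root_poly R)\<^sup>2 = (\<Prod>r\<in>R. [:- r\<^sup>2, 1:]) \<circ>\<^sub>p monom 1 2"
    by (simp only: root_poly_def prod_power_distrib linear pcompose_prod)
  also have "(\<Prod>r\<in>R. [:- r\<^sup>2, 1:]) = root_poly R"
    using prod.reindex[OF inj, of "\<lambda>r. [:- r, 1:]"] by (simp add: root_poly_def image)
  finally show ?thesis by (simp add: binary_poly_iff_power2)
qed

lemma binary_poly_mult:
  "binary_poly p \<Longrightarrow> binary_poly q \<Longrightarrow> binary_poly (p * q :: 'a poly)"
  by (simp add: binary_poly_iff_power2 power_mult_distrib pcompose_mult)

lemma binary_poly_mult_cancel: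
  "binary_poly (p * q :: 'a poly) \<Longrightarrow> binary_poly q \<Longrightarrow> q \<noteq> 0 \<Longrightarrow> binary_poly p"
  by (auto simp: binary_poly_iff_power2 power_mult_distrib pcompose_mult)

lemma binary_poly_mod:
  assumes "binary_poly p" "binary_poly (q::'a poly)"
  shows "binary_poly (p mod q)"
proof (cases "q = 0 \<or> p mod q = 0")
  case True
  then show ?thesis using assms(1) by (auto simp: binary_poly_def binary_def)
next
  case False
  define d r where "d = p div q" and "r = p mod q"
  have p_eq: "p = d * q + r" by (simp add: d_def r_def)
  have "degree r < degree q" using False degree_mod_less[of q p] by (simp add: r_def)
  then have degrees: "degree (r\<^sup>2) < degree (q\<^sup>2)" "degree (r \<circ>\<^sub>p monom 1 2) < degree (q\<^sup>2)"
    using False by (simp_all add: degree_power_eq degree_pcompose degree_monom_eq r_def)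
  have "r\<^sup>2 = (d\<^sup>2 * q\<^sup>2 + r\<^sup>2) mod q\<^sup>2" using degrees by (simp add: mod_poly_less)
  also have "d\<^sup>2 * q\<^sup>2 + r\<^sup>2 = p\<^sup>2"
    using char_2 by (simp add: p_eq freshmans_dream power_mult_distrib)
  also have "\<dots> = (d \<circ>\<^sub>p monom 1 2) * q\<^sup>2 + r \<circ>\<^sub>p monom 1 2"
    using assms by (simp add: binary_poly_iff_power2) (simp add: p_eq pcompose_add pcompose_mult)
  also have "\<dots> mod q\<^sup>2 = r \<circ>\<^sub>p monom 1 2" using degrees by (simp add: mod_poly_less)
  finally show ?thesis by (simp add: binary_poly_iff_power2 r_def)
qed

lemma poly_binary_power2:
  assumes "binary_poly (q::'a poly)"
  shows "poly q (x\<^sup>2) = (poly q x)\<^sup>2"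
  using arg_cong[OF assms[unfolded binary_poly_iff_power2], of "\<lambda>p. poly p x"]
  by (simp add: poly_pcompose poly_monom)

end

subsection \<open>Binary cyclic codes\<close>

definition binary_polys_below :: "nat \<Rightarrow> 'a::field poly set" where
  "binary_polys_below n = {p. binary_poly p \<and> (p = 0 \<or> degree p < n)}"

lemma binary_polys_below_altdef:
  "binary_polys_below n = {p. binary_poly p \<and> (\<forall>i\<ge>n. coeff p i = 0)}"
proof -
  have "p = 0 \<or> degree p < n \<longleftrightarrow> (\<forall>i\<ge>n. coeff p i = 0)" for p :: "'a poly"
    by (metis coeff_0 coeff_eq_0 leading_coeff_0_iff linorder_not_less order_less_le_trans)
  then show ?thesis by (simp add: binary_polys_below_def)
qed

lemma card_binary_polys_below: "card (binary_polys_below n :: 'a::field poly set) = 2 ^ n"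
proof -
  let ?poly_of = "\<lambda>S. \<Sum>i\<in>S. monom (1::'a) i"
  have coeff: "coeff (?poly_of S) i = (if i \<in> S then 1 else 0)" if "S \<subseteq> {..<n}" for S i
    using finite_subset[OF that] by (simp add: coeff_sum)
  have "bij_betw ?poly_of (Pow {..<n}) (binary_polys_below n)"
  proof (rule bij_betw_byWitness[where f' = "\<lambda>p. {i. coeff p i \<noteq> 0}"])
    show "\<forall>p\<in>binary_polys_below n. ?poly_of {i. coeff p i \<noteq> 0} = p"
    proof
      fix p :: "'a poly" assume p: "p \<in> binary_polys_below n"
      then have "{i. coeff p i \<noteq> 0} \<subseteq> {..<n}"
        by (auto simp: binary_polys_below_altdef linorder_not_le[symmetric])
      then show "?poly_of {i. coeff p i \<noteq> 0} = p"
        using p by (auto simp: poly_eq_iff coeff binary_polys_below_def binary_poly_def binary_def)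
    qed
    show "?poly_of ` Pow {..<n} \<subseteq> binary_polys_below n"
      using coeff by (force simp: binary_polys_below_altdef binary_poly_def binary_def)
  qed (use coeff in \<open>force simp: binary_polys_below_altdef linorder_not_le[symmetric]\<close>)+
  then have "card (binary_polys_below n :: 'a poly set) = card (Pow {..<n})"
    by (rule bij_betw_same_card[symmetric])
  then show ?thesis by (simp add: card_Pow)
qed

lemma finite_hamming_dists: "finite {hamming_dist v c c' |c c'. P c c'}"
proof (rule finite_subset)
  show "{hamming_dist v c c' |c c'. P c c'} \<subseteq> {..card {..<v}}"
    unfolding hamming_dist_def by (auto intro!: card_mono simp del: card_lessThan)
qed simp

lemma min_dist_le_hamming_dist:
  "c \<in> C \<Longrightarrow> c' \<in> C \<Longrightarrow> c \<noteq> c' \<Longrightarrow> min_dist v C \<le> hamming_dist v c c'"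
  unfolding min_dist_def by (intro Min_le finite_hamming_dists) blast

lemma le_min_dist:
  assumes "c \<in> C" "c' \<in> C" "c \<noteq> c'"
    and "\<And>c c'. c \<in> C \<Longrightarrow> c' \<in> C \<Longrightarrow> c \<noteq> c' \<Longrightarrow> n \<le> hamming_dist v c c'"
  shows "n \<le> min_dist v C"
  unfolding min_dist_def
  by (rule Min.boundedI[OF finite_hamming_dists]) (use assms in blast)+

lemma BCH_weight_bound:
  fixes p :: "'a::idom poly"
  assumes "p \<noteq> 0" "degree p < v" and inj: "inj_on (\<lambda>i. \<gamma> ^ i) {..<v}" and "b \<noteq> 0"
    and roots: "\<And>k. k < N \<Longrightarrow> poly p (b * \<gamma> ^ k) = 0"
  shows "N < card {i. coeff p i \<noteq> 0}"
proof (rule ccontr)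
  define S where "S = {i. coeff p i \<noteq> 0}"
  assume "\<not> N < card {i. coeff p i \<noteq> 0}"
  then have card_le: "card S \<le> N" by (simp add: S_def)
  have subset: "S \<subseteq> {..degree p}" by (auto simp: S_def le_degree)
  then have "finite S" by (rule finite_subset) simp
  have inj_S: "inj_on (\<lambda>i. \<gamma> ^ i) S" using subset assms(2) by (intro inj_on_subset[OF inj]) auto
  have eval: "poly p x = (\<Sum>i\<in>S. coeff p i * x ^ i)" for x
    unfolding poly_altdef using subset by (intro sum.mono_neutral_right) (auto simp: S_def)
  have power_sums: "(\<Sum>i\<in>S. (coeff p i * b ^ i) * (\<gamma> ^ i) ^ k) = 0" if "k < N" for k
    using roots[OF that] unfolding eval
    by (simp add: power_mult_distrib power_commutes mult_ac flip: power_mult)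
  have "coeff p i * b ^ i = 0" if "i \<in> S" for i
    by (rule power_sums_eq_0_imp_coeff_eq_0[where c = "\<lambda>i. coeff p i * b ^ i",
          OF \<open>finite S\<close> card_le inj_S power_sums that])
  then have "S = {}" using \<open>b \<noteq> 0\<close> by (auto simp: S_def)
  then show False using \<open>p \<noteq> 0\<close> by (auto simp: S_def poly_eq_iff)
qed

locale cyclic_generator =
  fixes v :: nat and g :: "'a::field poly"
  assumes char_2: "CHAR('a) = 2" and length_pos: "v > 0"
    and binary_g: "binary_poly g" and g_dvd: "g dvd monom 1 v - 1"
begin

lemma degree_modulus: "degree (monom 1 v - 1 :: 'a poly) = v"
  using degree_add_eq_left[of "- 1 :: 'a poly" "monom 1 v"] length_pos
  by (simp add: degree_monom_eq)

lemma modulus_nonzero: "monom 1 v - 1 \<noteq> (0 :: 'a poly)"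
  using degree_modulus length_pos by force

lemma g_nonzero: "g \<noteq> 0"
  using g_dvd modulus_nonzero by auto

lemma cyclic_code_eq: "cyclic_code v g = {c \<in> binary_polys_below v. g dvd c}"
proof (intro equalityI subsetI)
  fix c assume "c \<in> cyclic_code v g"
  then obtain a where "binary_poly a" and c_eq: "c = (a * g) mod (monom 1 v - 1)"
    by (auto simp: cyclic_code_def)
  have "binary_poly (monom 1 v - 1 :: 'a poly)"
    by (auto simp: binary_poly_def binary_def coeff_1 uminus_CHAR_2[OF char_2])
  then have "binary_poly c"
    unfolding c_eq using \<open>binary_poly a\<close> binary_g by (intro binary_poly_mod binary_poly_mult char_2)
  moreover have "g dvd c" unfolding c_eq using g_dvd by (intro dvd_mod) auto
  moreover have "c = 0 \<or> degree c < v"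
    using degree_mod_less[OF modulus_nonzero, of "a * g"] by (simp add: c_eq degree_modulus)
  ultimately show "c \<in> {c \<in> binary_polys_below v. g dvd c}" by (simp add: binary_polys_below_def)
next
  fix c assume "c \<in> {c \<in> binary_polys_below v. g dvd c}"
  then have "binary_poly c" and small: "c = 0 \<or> degree c < v" and "g dvd c"
    by (auto simp: binary_polys_below_def)
  then obtain a where c_eq: "c = a * g" by (metis dvdE mult.commute)
  have "binary_poly a"
    using \<open>binary_poly c\<close> c_eq binary_g g_nonzero binary_poly_mult_cancel[OF char_2] by simp
  moreover have "c = (a * g) mod (monom 1 v - 1)"
    using small c_eq by (auto simp: mod_poly_less degree_modulus)
  ultimately show "c \<in> cyclic_code v g" by (auto simp: cyclic_code_def)
qed

lemma card_cyclic_code: "card (cyclic_code v g) = 2 ^ (v - degree g)"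
proof -
  have "g * a \<in> binary_polys_below v \<longleftrightarrow> a \<in> binary_polys_below (v - degree g)" for a
  proof -
    have "binary_poly (g * a) \<longleftrightarrow> binary_poly a"
      using binary_poly_mult[OF char_2 binary_g]
        binary_poly_mult_cancel[OF char_2 _ binary_g g_nonzero]
      by (auto simp: mult.commute)
    moreover have "g * a = 0 \<or> degree (g * a) < v \<longleftrightarrow> a = 0 \<or> degree a < v - degree g"
      using g_nonzero by (cases "a = 0") (auto simp: degree_mult_eq)
    ultimately show ?thesis by (simp add: binary_polys_below_def)
  qed
  then have "cyclic_code v g = (\<lambda>a. g * a) ` binary_polys_below (v - degree g)"
    unfolding cyclic_code_eq by (auto elim!: dvdE)
  then show ?thesis by (simp add: card_image inj_on_def g_nonzero card_binary_polys_below)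
qed

lemma zero_in_cyclic_code: "0 \<in> cyclic_code v g"
  by (simp add: cyclic_code_eq binary_polys_below_def binary_poly_def binary_def)

lemma generator_in_cyclic_code: "degree g < v \<Longrightarrow> g \<in> cyclic_code v g"
  by (simp add: cyclic_code_eq binary_polys_below_def binary_g)

lemma min_dist_cyclic_code_le:
  assumes "degree g < v"
  shows "min_dist v (cyclic_code v g) \<le> 1 + degree g"
proof -
  have "min_dist v (cyclic_code v g) \<le> hamming_dist v g 0"
    using generator_in_cyclic_code[OF assms] zero_in_cyclic_code g_nonzero
    by (rule min_dist_le_hamming_dist)
  also have "\<dots> \<le> card {..degree g}"
    unfolding hamming_dist_def by (intro card_mono) (auto intro: le_degree)
  finally show ?thesis by simp
qed

lemma BCH_bound:
  assumes deg: "degree g < v" and inj: "inj_on (\<lambda>i. \<gamma> ^ i) {..<v}" and "b \<noteq> 0"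
    and roots: "\<And>k. k < N \<Longrightarrow> poly g (b * \<gamma> ^ k) = 0"
  shows "N + 1 \<le> min_dist v (cyclic_code v g)"
proof (rule le_min_dist[OF generator_in_cyclic_code[OF deg] zero_in_cyclic_code g_nonzero])
  fix c c' assume "c \<in> cyclic_code v g" "c' \<in> cyclic_code v g" "c \<noteq> c'"
  then have diff: "c - c' \<noteq> 0" "g dvd c - c'" "degree c < v" "degree c' < v"
    using length_pos by (auto simp: cyclic_code_eq binary_polys_below_def)
  then have "degree (c - c') < v" by (intro degree_diff_less)
  moreover have "poly (c - c') (b * \<gamma> ^ k) = 0" if "k < N" for k
    using roots[OF that] diff(2) by (auto simp: dvd_def simp del: poly_diff)
  ultimately have "N < card {i. coeff (c - c') i \<noteq> 0}"
    using diff(1) inj \<open>b \<noteq> 0\<close> by (intro BCH_weight_bound)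
  also have "{i. coeff (c - c') i \<noteq> 0} = {i. i < v \<and> coeff c i \<noteq> coeff c' i}"
    using diff by (auto simp: coeff_eq_0 intro: ccontr)
  finally show "N + 1 \<le> hamming_dist v c c'" by (simp add: hamming_dist_def)
qed

end

subsection \<open>Conjugates and minimal polynomials over the prime field\<close>

definition conjugates :: "'a::monoid_mult \<Rightarrow> 'a set" where
  "conjugates b = range (\<lambda>k. b ^ 2 ^ k)"

lemma self_in_conjugates: "b \<in> conjugates b"
  unfolding conjugates_def by (rule range_eqI[of _ _ 0]) simp

lemma power2_in_conjugates:
  assumes "x \<in> conjugates b"
  shows "x\<^sup>2 \<in> conjugates b"
proof -
  obtain k where "x = b ^ 2 ^ k" using assms by (auto simp: conjugates_def)
  then have "x\<^sup>2 = b ^ 2 ^ Suc k" by (simp add: mult.commute flip: power_mult)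
  then show ?thesis unfolding conjugates_def by (rule range_eqI)
qed

lemma zero_notin_conjugates: "b \<noteq> 0 \<Longrightarrow> 0 \<notin> conjugates (b::'a::semidom)"
  by (auto simp: conjugates_def)

lemma binary_root_poly_UN_conjugates:
  fixes c :: "'i \<Rightarrow> 'a::field"
  assumes "CHAR('a) = 2" "finite (\<Union>i\<in>I. conjugates (c i))"
  shows "binary_poly (root_poly (\<Union>i\<in>I. conjugates (c i)))"
  using assms power2_in_conjugates by (intro binary_root_poly) blast+

lemma poly_binary_conjugate:
  fixes q :: "'a::field poly"
  assumes "CHAR('a) = 2" "binary_poly q" "poly q b = 0" "x \<in> conjugates b"
  shows "poly q x = 0"
proof -
  have "poly q (b ^ 2 ^ k) = 0" for k
  proof (induction k)
    case (Suc k)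
    then show ?case
      using poly_binary_power2[OF assms(1,2), of "b ^ 2 ^ k"]
      by (simp add: mult.commute flip: power_mult)
  qed (simp add: assms)
  then show ?thesis using assms(4) by (auto simp: conjugates_def)
qed

lemma min_poly_F2_eq_root_poly:
  fixes b :: "'a::field"
  assumes char_2: "CHAR('a) = 2" and fin: "finite (conjugates b)"
  shows "min_poly_F2 b = root_poly (conjugates b)"
proof -
  have binary: "binary_poly (root_poly (conjugates b))"
    using fin power2_in_conjugates by (rule binary_root_poly[OF char_2])
  have root: "poly (root_poly (conjugates b)) b = 0"
    by (simp add: poly_root_poly_eq_0_iff fin self_in_conjugates)
  have dvd: "root_poly (conjugates b) dvd q" if "binary_poly q" "poly q b = 0" for q
    using poly_binary_conjugate[OF char_2 that] by (simp add: root_poly_dvd_iff fin)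
  have "is_min_poly_F2 b (root_poly (conjugates b))"
    unfolding is_min_poly_F2_def
    using binary root dvd lead_coeff_root_poly by (blast intro: dvd_imp_degree_le)
  moreover have "p = root_poly (conjugates b)" if "is_min_poly_F2 b p" for p
    using that binary root unfolding is_min_poly_F2_def
    by (intro monic_dvd_imp_eq dvd lead_coeff_root_poly) (auto simp: root_poly_nonzero)
  ultimately show ?thesis unfolding min_poly_F2_def by (rule the_equality)
qed

subsection \<open>Sequences that are sums of geometric progressions\<close>

lemma recurrence_sum_power_sum:
  fixes R :: "'a::field set"
  assumes "0 \<notin> R" and s_eq: "\<And>t. s t = (\<Sum>r\<in>R. c r * inverse r ^ t)" and "degree q \<le> i"
  shows "(\<Sum>k\<le>degree q. coeff q k * s (i - k)) = (\<Sum>r\<in>R. c r * inverse r ^ i * poly q r)"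
proof -
  have "(\<Sum>k\<le>degree q. coeff q k * s (i - k)) =
      (\<Sum>r\<in>R. \<Sum>k\<le>degree q. coeff q k * (c r * inverse r ^ (i - k)))"
    unfolding s_eq sum_distrib_left by (rule sum.swap)
  also have "\<dots> = (\<Sum>r\<in>R. \<Sum>k\<le>degree q. c r * inverse r ^ i * (coeff q k * r ^ k))"
  proof (intro sum.cong refl)
    fix r k assume "r \<in> R" "k \<in> {..degree q}"
    then have "r \<noteq> 0" "k \<le> i" using assms(1,3) by auto
    then show "coeff q k * (c r * inverse r ^ (i - k)) = c r * inverse r ^ i * (coeff q k * r ^ k)"
      by (simp add: power_diff field_simps)
  qed
  finally show ?thesis by (simp add: poly_altdef sum_distrib_left)
qed

lemma lin_rec_power_sum_iff:
  fixes R :: "'a::field set"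
  assumes "finite R" "0 \<notin> R" and coeff_nonzero: "\<And>r. r \<in> R \<Longrightarrow> c r \<noteq> 0"
    and s_eq: "\<And>t. s t = (\<Sum>r\<in>R. c r * inverse r ^ t)"
  shows "lin_rec q s \<longleftrightarrow> (\<forall>r\<in>R. poly q r = 0)"
proof (intro iffI ballI)
  fix r assume rec: "lin_rec q s" and "r \<in> R"
  let ?coeff = "\<lambda>r. c r * inverse r ^ degree q * poly q r"
  have power_sums: "(\<Sum>r\<in>R. ?coeff r * inverse r ^ k) = 0" for k
  proof -
    have "(\<Sum>r\<in>R. c r * inverse r ^ (degree q + k) * poly q r) = 0"
      using rec recurrence_sum_power_sum[OF \<open>0 \<notin> R\<close> s_eq, of q "degree q + k"]
      unfolding lin_rec_def by simp
    then show ?thesis by (simp add: power_add mult_ac)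
  qed
  have "inj_on inverse R" by (simp add: inj_on_def)
  from power_sums_eq_0_imp_coeff_eq_0[OF \<open>finite R\<close> le_refl this power_sums \<open>r \<in> R\<close>]
  show "poly q r = 0" using coeff_nonzero \<open>0 \<notin> R\<close> \<open>r \<in> R\<close> by auto
next
  assume "\<forall>r\<in>R. poly q r = 0"
  then show "lin_rec q s"
    unfolding lin_rec_def by (simp add: recurrence_sum_power_sum[OF \<open>0 \<notin> R\<close> s_eq])
qed

lemma seq_min_poly_power_sum:
  fixes R :: "'a::field set"
  assumes fin: "finite R" and zero_notin: "0 \<notin> R" and coeff_nonzero: "\<And>r. r \<in> R \<Longrightarrow> c r \<noteq> 0"
    and s_eq: "\<And>t. s t = (\<Sum>r\<in>R. c r * inverse r ^ t)"
    and binary: "binary_poly (root_poly R)"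
  shows "seq_min_poly s = root_poly R"
proof -
  have rec_iff: "lin_rec q s \<longleftrightarrow> root_poly R dvd q" for q
    using lin_rec_power_sum_iff[OF fin zero_notin coeff_nonzero s_eq]
    by (simp add: root_poly_dvd_iff fin)
  have "poly (root_poly R) 0 \<noteq> 0" using fin zero_notin by (simp add: poly_root_poly_eq_0_iff)
  then have const: "coeff (root_poly R) 0 = 1"
    using binary unfolding binary_poly_def binary_def by (auto simp: poly_0_coeff_0)
  have "is_seq_min_poly s (root_poly R)"
    unfolding is_seq_min_poly_def using const binary
    by (auto simp: rec_iff intro!: dvd_imp_degree_le)
  moreover have "q = root_poly R" if q: "is_seq_min_poly s q" for q
  proof (rule monic_dvd_imp_eq)
    have "q \<noteq> 0" using q unfolding is_seq_min_poly_def by auto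
    then show "lead_coeff q = 1"
      using q unfolding is_seq_min_poly_def binary_poly_def binary_def
      by (metis leading_coeff_0_iff)
    show "root_poly R dvd q" "degree q \<le> degree (root_poly R)"
      using q const binary unfolding is_seq_min_poly_def by (auto simp: rec_iff)
  qed (rule lead_coeff_root_poly)
  ultimately show ?thesis unfolding seq_min_poly_def by (rule the_equality)
qed

subsection \<open>Finite fields\<close>

lemma two_le_card_UNIV: "2 \<le> card (UNIV :: 'a::{finite,zero_neq_one} set)"
  using card_mono[of UNIV "{0, 1 :: 'a}"] by simp

lemma CHAR_eq_2_if_card:
  assumes "card (UNIV :: 'a::{finite,field} set) = 2 ^ m"
  shows "CHAR('a) = 2"
proof -
  have "prime CHAR('a)" by (intro prime_CHAR_semidom finite_imp_CHAR_pos) simp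
  moreover have "CHAR('a) dvd 2 ^ m" using CHAR_dvd_CARD[where 'a = 'a] assms by simp
  ultimately show ?thesis
    using prime_dvd_power primes_dvd_imp_eq two_is_prime_nat by blast
qed

(* finite_field_power_card_eq_same cannot be used here: it needs the class finite_field, of which
   the sort {finite, field} is not an instance. *)
lemma power_card_minus_one:
  fixes x :: "'a::{finite,field}"
  assumes "x \<noteq> 0"
  shows "x ^ (card (UNIV :: 'a set) - 1) = 1"
proof -
  let ?U = "UNIV - {0::'a}"
  have "(\<Prod>y\<in>?U. x * y) = \<Prod>?U"
    using assms by (intro prod.reindex_bij_witness[of _ "\<lambda>y. y / x" "\<lambda>y. x * y"]) auto
  then have "x ^ card ?U * \<Prod>?U = \<Prod>?U" by (simp add: prod.distrib)
  moreover have "\<Prod>?U \<noteq> 0" by simp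
  ultimately have "x ^ card ?U = 1" by simp
  then show ?thesis by (simp add: card_Diff_singleton)
qed

lemma power_card:
  fixes x :: "'a::{finite,field}"
  shows "x ^ card (UNIV :: 'a set) = x"
proof (cases "x = 0")
  case False
  have "x ^ card (UNIV :: 'a set) = x * x ^ (card (UNIV :: 'a set) - 1)"
    by (simp add: card_gt_0_iff flip: power_Suc)
  then show ?thesis using power_card_minus_one[OF False] by simp
qed (simp add: card_gt_0_iff)

lemma root_poly_dvd_monom_minus_one:
  fixes R :: "'a::{finite,field} set"
  assumes "0 \<notin> R"
  shows "root_poly R dvd monom 1 (card (UNIV :: 'a set) - 1) - 1"
proof -
  have "r ^ (card (UNIV :: 'a set) - 1) = 1" if "r \<in> R" for r
    using that assms by (intro power_card_minus_one) blast
  then show ?thesis by (simp add: root_poly_dvd_iff poly_monom)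
qed

lemma conjugates_eq_image:
  fixes b :: "'a::{finite,field}"
  assumes card: "card (UNIV :: 'a set) = 2 ^ m"
  shows "conjugates b = (\<lambda>k. b ^ 2 ^ k) ` {..<m}"
proof (intro equalityI subsetI)
  have "m > 0" using two_le_card_UNIV[where 'a = 'a] card by (cases m) auto
  have cycle: "x ^ (2 ^ m) ^ n = x" for x :: 'a and n
    by (induction n) (use power_card[where 'a = 'a] card in \<open>simp_all add: power_add power_mult\<close>)
  fix x assume "x \<in> conjugates b"
  then obtain k where "x = b ^ 2 ^ (m * (k div m) + k mod m)" by (auto simp: conjugates_def)
  then have "x = b ^ 2 ^ (k mod m)" by (simp only: power_add power_mult cycle)
  then show "x \<in> (\<lambda>k. b ^ 2 ^ k) ` {..<m}" using \<open>m > 0\<close> by auto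
qed (auto simp: conjugates_def)

lemma sum_conjugates:
  fixes b :: "'a::{finite,field}"
  assumes card: "card (UNIV :: 'a set) = 2 ^ m" and full: "card (conjugates b) = m"
  shows "sum f (conjugates b) = (\<Sum>k<m. f (b ^ 2 ^ k))"
proof -
  have "inj_on (\<lambda>k. b ^ 2 ^ k) {..<m}"
    using full unfolding conjugates_eq_image[OF card] by (intro eq_card_imp_inj_on) auto
  then show ?thesis unfolding conjugates_eq_image[OF card] by (simp add: sum.reindex)
qed

lemma seq_min_poly_sum_trace:
  fixes c :: "'i \<Rightarrow> 'a::{finite,field}"
  assumes card: "card (UNIV :: 'a set) = 2 ^ m"
    and "finite I" and nonzero: "\<And>i. i \<in> I \<Longrightarrow> c i \<noteq> 0"
    and disjoint: "disjoint_family_on (\<lambda>i. conjugates (c i)) I"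
    and full: "\<And>i. i \<in> I \<Longrightarrow> card (conjugates (c i)) = m"
    and s_eq: "\<And>t. s t = (\<Sum>i\<in>I. trace m (inverse (c i) ^ t))"
  shows "seq_min_poly s = root_poly (\<Union>i\<in>I. conjugates (c i))"
proof -
  let ?R = "\<Union>i\<in>I. conjugates (c i)"
  have "s t = (\<Sum>r\<in>?R. 1 * inverse r ^ t)" for t
  proof -
    have "trace m (inverse (c i) ^ t) = (\<Sum>r\<in>conjugates (c i). inverse r ^ t)" if "i \<in> I" for i
      unfolding trace_def sum_conjugates[OF card full[OF that]]
      by (intro sum.cong refl) (simp add: power_inverse mult.commute flip: power_mult)
    then have "s t = (\<Sum>i\<in>I. \<Sum>r\<in>conjugates (c i). inverse r ^ t)" by (simp add: s_eq)
    also have "\<dots> = (\<Sum>r\<in>?R. inverse r ^ t)"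
      using disjoint \<open>finite I\<close>
      by (intro sum.UNION_disjoint[symmetric]) (auto simp: disjoint_family_on_def)
    finally show ?thesis by simp
  qed
  moreover have "binary_poly (root_poly ?R)"
    by (intro binary_root_poly_UN_conjugates CHAR_eq_2_if_card[OF card]) simp
  ultimately show ?thesis
    using nonzero zero_notin_conjugates
    by (intro seq_min_poly_power_sum[where c = "\<lambda>_. 1"]) auto
qed

lemma primitive_inverse: "primitive a \<Longrightarrow> primitive (inverse a)"
  unfolding primitive_def by (metis inverse_inverse_eq inverse_nonzero_iff_nonzero power_inverse)

lemma primitive_power_eq_iff_cong:
  fixes a :: "'a::{finite,field}"
  assumes "primitive a"
  shows "a ^ i = a ^ j \<longleftrightarrow> [i = j] (mod card (UNIV :: 'a set) - 1)"
proof -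
  let ?v = "card (UNIV :: 'a set) - 1"
  have nonzero: "a \<noteq> 0" using assms by (simp add: primitive_def)
  have "?v > 0" using two_le_card_UNIV[where 'a = 'a] by simp
  have reduce: "a ^ k = a ^ (k mod ?v)" for k
  proof -
    have "a ^ k = a ^ (?v * (k div ?v) + k mod ?v)" by simp
    also have "\<dots> = a ^ (k mod ?v)"
      unfolding power_add power_mult power_card_minus_one[OF nonzero] by simp
    finally show ?thesis .
  qed
  have "UNIV - {0} \<subseteq> (\<lambda>k. a ^ k) ` {..<?v}"
  proof
    fix x assume "x \<in> UNIV - {0 :: 'a}"
    then obtain k where "x = a ^ k" using assms unfolding primitive_def by auto
    then show "x \<in> (\<lambda>k. a ^ k) ` {..<?v}" using reduce[of k] \<open>?v > 0\<close> by auto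
  qed
  then have "(\<lambda>k. a ^ k) ` {..<?v} = UNIV - {0}" using nonzero by auto
  then have "card ((\<lambda>k. a ^ k) ` {..<?v}) = card {..<?v}" by (simp add: card_Diff_singleton)
  then have "inj_on (\<lambda>k. a ^ k) {..<?v}" by (intro eq_card_imp_inj_on) auto
  then show ?thesis
    using \<open>?v > 0\<close> reduce[of i] reduce[of j] by (auto simp: cong_def inj_on_def)
qed

subsection \<open>Leaders of 2-cyclotomic cosets\<close>

lemma Gamma_iff: "i \<in> Gamma t \<longleftrightarrow> odd i \<and> i < 2 ^ t"
proof -
  have "i \<le> 2 ^ t - 1 \<longleftrightarrow> i < 2 ^ t"
    using zero_less_power[of "2::nat" t] by linarith
  then show ?thesis unfolding Gamma_def by (auto elim: oddE)
qed

lemma finite_Gamma: "finite (Gamma t)"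
  by (rule finite_subset[of _ "{..<2 ^ t}"]) (auto simp: Gamma_iff)

lemma card_Gamma: "card (Gamma (Suc t)) = 2 ^ t"
proof -
  have "Gamma (Suc t) = (\<lambda>k. 2 * k + 1) ` {..<2 ^ t}"
    by (auto simp: Gamma_iff elim!: oddE)
  then show ?thesis by (simp add: card_image inj_on_def)
qed

text \<open>In binary, these are the odd numbers with leading bits 11 and exactly \<open>h + 1\<close> bits, together
  with those with leading bits 10 and at most \<open>h\<close> bits.\<close>

definition coset_leaders :: "nat \<Rightarrow> nat set" where
  "coset_leaders h = (\<lambda>i. i + 2 ^ h) ` (Gamma h - Gamma (h - 1)) \<union>
     (\<Union>j\<in>{1..h - 2}. (\<lambda>i. i + 2 ^ (j + 1)) ` Gamma j)"

lemma finite_coset_leaders: "finite (coset_leaders h)"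
  by (simp add: coset_leaders_def finite_Gamma)

lemma low_coset_leader_less:
  assumes "j \<in> {1..h - 2}" "i \<in> Gamma j"
  shows "i + 2 ^ (j + 1) < 2 ^ h"
proof -
  have "i + 2 ^ (j + 1) < 2 ^ (j + 2)" using assms(2) by (simp add: Gamma_iff)
  also have "\<dots> \<le> 2 ^ h" using assms(1) by (intro power_increasing) auto
  finally show ?thesis .
qed

lemma coset_leaders_cases:
  assumes "e \<in> coset_leaders h" "h \<ge> 1"
  obtains (high) f where "e = 2 ^ h + f" "odd e" "2 ^ (h - 1) \<le> f" "f < 2 ^ h"
    | (low) "odd e" "e < 2 ^ h"
proof -
  from assms(1) consider (top) f where "f \<in> Gamma h - Gamma (h - 1)" "e = f + 2 ^ h"
    | (lower) j i where "j \<in> {1..h - 2}" "i \<in> Gamma j" "e = i + 2 ^ (j + 1)"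
    unfolding coset_leaders_def by auto
  then show thesis
  proof cases
    case top
    then show thesis using assms(2) by (intro high[of f]) (auto simp: Gamma_iff)
  next
    case lower
    then show thesis
      using low_coset_leader_less[OF lower(1,2)] by (intro low) (auto simp: Gamma_iff)
  qed
qed

lemma (in comm_monoid_set) coset_leaders_split:
  "F g (coset_leaders h) = f (F (\<lambda>i. g (i + 2 ^ h)) (Gamma h - Gamma (h - 1)))
     (F (\<lambda>j. F (\<lambda>i. g (i + 2 ^ (j + 1))) (Gamma j)) {1..h - 2})"
proof -
  let ?L = "\<lambda>j. (\<lambda>i. i + 2 ^ (j + 1)) ` Gamma j"
  have range: "2 ^ (j + 1) \<le> e \<and> e < 2 ^ (j + 2)" if "e \<in> ?L j" for e j
    using that by (auto simp: Gamma_iff)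
  have "?L j \<inter> ?L j' = {}" if "j < j'" for j j'
  proof -
    have "(2::nat) ^ (j + 2) \<le> 2 ^ (j' + 1)" using that by (intro power_increasing) auto
    then show ?thesis using range[of _ j] range[of _ j'] by fastforce
  qed
  then have disjoint: "?L j \<inter> ?L j' = {}" if "j \<noteq> j'" for j j'
    using that by (metis inf_commute nat_neq_iff)
  have "F g (coset_leaders h) = f (F g ((\<lambda>i. i + 2 ^ h) ` (Gamma h - Gamma (h - 1))))
      (F g (\<Union>j\<in>{1..h - 2}. ?L j))"
    unfolding coset_leaders_def
    by (rule union_disjoint) (use low_coset_leader_less finite_Gamma in \<open>fastforce+\<close>)
  also have "F g (\<Union>j\<in>{1..h - 2}. ?L j) = F (\<lambda>j. F g (?L j)) {1..h - 2}"
    using disjoint by (intro UNION_disjoint) (auto simp: finite_Gamma)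
  finally show ?thesis by (simp add: reindex inj_on_def comp_def)
qed

lemma card_coset_leaders:
  assumes "h \<ge> 2"
  shows "card (coset_leaders h) = 2 ^ (h - 1) - 1"
proof -
  obtain k where h_eq: "h = Suc (Suc k)" using assms by (metis add_2_eq_Suc le_Suc_ex)
  have "Gamma (Suc k) \<subseteq> Gamma (Suc (Suc k))" by (auto simp: Gamma_iff)
  then have "card (Gamma (Suc (Suc k)) - Gamma (Suc k)) = 2 ^ k"
    by (simp add: card_Diff_subset finite_Gamma card_Gamma)
  moreover have "(\<Sum>j\<in>{1..k}. card (Gamma j)) = 2 ^ k - 1"
    by (induction k) (simp_all add: card_Gamma)
  ultimately show ?thesis
    using sum.coset_leaders_split[of "\<lambda>_. 1::nat" h] by (simp add: h_eq)
qed

lemma arith_progression_in_coset_leaders: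
  assumes "h \<ge> 2" "j < 2 ^ (h - 2)"
  shows "3 * 2 ^ (h - 1) + 1 + 2 * j \<in> coset_leaders h"
proof -
  obtain k where h_eq: "h = Suc (Suc k)" using assms(1) by (metis add_2_eq_Suc le_Suc_ex)
  have "2 ^ Suc k + 1 + 2 * j \<in> Gamma h - Gamma (h - 1)"
    using assms(2) by (auto simp: Gamma_iff h_eq)
  then have "(2 ^ Suc k + 1 + 2 * j) + 2 ^ h \<in> coset_leaders h"
    unfolding coset_leaders_def by blast
  then show ?thesis by (simp add: h_eq)
qed

lemma mult_power_two_add_le:
  fixes e :: nat
  assumes "e < 2 ^ a" "a + d \<le> n"
  shows "e * 2 ^ d + 2 ^ d \<le> 2 ^ n"
proof -
  have "e * 2 ^ d + 2 ^ d = Suc e * 2 ^ d" by simp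
  also have "\<dots> \<le> 2 ^ a * 2 ^ d" using assms(1) by (intro mult_right_mono) auto
  also have "\<dots> \<le> 2 ^ n" using assms(2) by (simp flip: power_add)
  finally show ?thesis .
qed

lemma power_two_cong_1: "[2 ^ n = 1] (mod 2 ^ n - 1 :: nat)"
  by (simp add: cong_altdef_nat)

lemma coset_leader_shift_less:
  assumes "h \<ge> 2" "e \<in> coset_leaders h" "d \<le> h" "d = h \<longrightarrow> e < 2 ^ h"
  shows "e * 2 ^ d < 2 ^ (2 * h) - 1"
proof -
  have less: "e < 2 ^ (h + 1)" using assms(1,2) by (elim coset_leaders_cases) auto
  have shift_less: "e * 2 ^ c < 2 ^ (2 * h) - 1" if "e < 2 ^ a" "a + c \<le> 2 * h" "c > 0" for a c
  proof -
    have "(2::nat) ^ 1 \<le> 2 ^ c" using that(3) by (intro power_increasing) auto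
    then show ?thesis using mult_power_two_add_le[OF that(1,2)] by simp
  qed
  consider "d = 0" | "0 < d" "d < h" | "d = h" using assms(3) by linarith
  then show ?thesis
  proof cases
    assume "d = 0"
    then show ?thesis using shift_less[OF less, of 1] assms(1) by simp
  next
    assume "0 < d" "d < h"
    then show ?thesis using shift_less[OF less, of d] by simp
  next
    assume "d = h"
    then show ?thesis using shift_less[of h d] assms(1,4) by simp
  qed
qed

lemma high_coset_leader_shift_not_cong:
  assumes "h \<ge> 2" "e \<in> coset_leaders h" "e' \<in> coset_leaders h" "2 ^ h \<le> e'"
  shows "\<not> [e = e' * 2 ^ h] (mod 2 ^ (2 * h) - 1)"
proof
  assume cong: "[e = e' * 2 ^ h] (mod 2 ^ (2 * h) - 1)"
  obtain f where e'_eq: "e' = 2 ^ h + f" and f_bounds: "2 ^ (h - 1) \<le> f" "f < 2 ^ h"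
    using assms by (auto elim: coset_leaders_cases)
  have "e' * 2 ^ h = 2 ^ (2 * h) + f * 2 ^ h"
    unfolding e'_eq by (simp add: algebra_simps mult_2 flip: power_add)
  then have "[e' * 2 ^ h = 1 + f * 2 ^ h] (mod 2 ^ (2 * h) - 1)"
    by (simp only: cong_add[OF power_two_cong_1 cong_refl])
  with cong have "[e = 1 + f * 2 ^ h] (mod 2 ^ (2 * h) - 1)" by (rule cong_trans)
  moreover have "e < 2 ^ (2 * h) - 1"
    using coset_leader_shift_less[OF assms(1,2), of 0] assms(1) by simp
  moreover have "1 + f * 2 ^ h < 2 ^ (2 * h) - 1"
  proof -
    have "(2::nat) ^ 2 \<le> 2 ^ h" using assms(1) by (intro power_increasing) auto
    then show ?thesis using mult_power_two_add_le[OF f_bounds(2), of h "2 * h"] by simp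
  qed
  ultimately have "e = 1 + f * 2 ^ h" by (rule cong_less_modulus_unique_nat)
  moreover have "2 ^ (h + 1) \<le> f * 2 ^ h"
  proof -
    have "(2::nat) ^ (h + 1) \<le> 2 ^ (h - 1 + h)" using assms(1) by (intro power_increasing) auto
    also have "\<dots> \<le> f * 2 ^ h"
      unfolding power_add using f_bounds(1) by (rule mult_right_mono) simp
    finally show ?thesis .
  qed
  moreover have "e < 2 ^ (h + 1)" using assms(1,2) by (elim coset_leaders_cases) auto
  ultimately show False by simp
qed

lemma coset_leaders_cong_shift_imp_eq:
  assumes "h \<ge> 2" "e \<in> coset_leaders h" "e' \<in> coset_leaders h" "d \<le> h"
    and cong: "[e = e' * 2 ^ d] (mod 2 ^ (2 * h) - 1)"
  shows "d = 0 \<and> e = e'"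
proof -
  have "d = h \<longrightarrow> e' < 2 ^ h"
    using high_coset_leader_shift_not_cong[OF assms(1-3)] cong by (auto simp: not_le[symmetric])
  then have "e' * 2 ^ d < 2 ^ (2 * h) - 1"
    using assms by (intro coset_leader_shift_less)
  moreover have "e < 2 ^ (2 * h) - 1"
    using coset_leader_shift_less[OF assms(1,2), of 0] assms(1) by simp
  ultimately have "e = e' * 2 ^ d" using cong by (intro cong_less_modulus_unique_nat)
  moreover have "odd e" using assms(1,2) by (auto elim: coset_leaders_cases)
  ultimately show ?thesis by (cases d) auto
qed

lemma coset_leaders_cong_imp_eq:
  assumes h_ge_2: "h \<ge> 2"
    and "e \<in> coset_leaders h" "e' \<in> coset_leaders h" "k < 2 * h" "k' < 2 * h"
    and "[e * 2 ^ k = e' * 2 ^ k'] (mod 2 ^ (2 * h) - 1)"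
  shows "e = e' \<and> k = k'"
  using assms(2-)
proof (induction k k' arbitrary: e e' rule: linorder_wlog)
  case (le k k')
  define d where "d = k' - k"
  have k'_eq: "k' = d + k" and d_less: "d < 2 * h" using le by (auto simp: d_def)
  have "coprime (2 ^ k) (2 ^ (2 * h) - 1 :: nat)" using h_ge_2 by simp
  then have cong: "[e = e' * 2 ^ d] (mod 2 ^ (2 * h) - 1)"
    using le.prems(5) by (simp add: k'_eq power_add cong_mult_rcancel_nat flip: mult.assoc)
  show ?case
  proof (cases "d \<le> h")
    case True
    then show ?thesis
      using coset_leaders_cong_shift_imp_eq[OF h_ge_2 le.prems(1,2) _ cong] k'_eq by simp
  next
    case False
    have "[e * 2 ^ (2 * h - d) = e' * 2 ^ d * 2 ^ (2 * h - d)] (mod 2 ^ (2 * h) - 1)"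
      using cong by (rule cong_scalar_right)
    also have "e' * 2 ^ d * 2 ^ (2 * h - d) = e' * 2 ^ (2 * h)"
      using d_less by (simp add: mult.assoc flip: power_add)
    also have "[e' * 2 ^ (2 * h) = e' * 1] (mod 2 ^ (2 * h) - 1)"
      by (intro cong_scalar_left power_two_cong_1)
    finally have "[e' = e * 2 ^ (2 * h - d)] (mod 2 ^ (2 * h) - 1)"
      by (simp add: cong_sym)
    from coset_leaders_cong_shift_imp_eq[OF h_ge_2 le.prems(2,1) _ this] have "2 * h - d = 0"
      using False by simp
    then show ?thesis using d_less by simp
  qed
next
  case (sym k k')
  then show ?case by (metis cong_sym)
qed

subsection \<open>The trace expansion of the sequence\<close>

lemma power_two_power_minus_one_CHAR_2:
  fixes x :: "'a::comm_semiring_1"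
  assumes char_2: "CHAR('a) = 2"
  shows "(x + 1) ^ (2 ^ k - 1) = (\<Sum>i<2 ^ k. x ^ i)"
proof (induction k)
  case (Suc k)
  have "(2::nat) ^ Suc k - 1 = 2 ^ k + (2 ^ k - 1)" by simp
  then have "(x + 1) ^ (2 ^ Suc k - 1) = (x + 1) ^ 2 ^ k * (x + 1) ^ (2 ^ k - 1)"
    by (simp only: power_add)
  also have "\<dots> = (x ^ 2 ^ k + 1) * (\<Sum>i<2 ^ k. x ^ i)"
    unfolding Suc using char_2 by (simp add: freshmans_dream')
  also have "\<dots> = (\<Sum>i<2 ^ k. x ^ i) + (\<Sum>i<2 ^ k. x ^ (i + 2 ^ k))"
    by (simp add: algebra_simps power_add sum_distrib_left sum.distrib)
  also have "(\<Sum>i<2 ^ k. x ^ (i + 2 ^ k)) = (\<Sum>i\<in>{2 ^ k..<2 ^ Suc k}. x ^ i)"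
    using sum.shift_bounds_nat_ivl[of "\<lambda>i. x ^ i" 0 "2 ^ k" "2 ^ k"]
    by (simp add: lessThan_atLeast0 mult_2)
  finally show ?case by (simp add: lessThan_atLeast0 sum.atLeastLessThan_concat)
qed simp

context
  assumes char_2: "CHAR('a::field) = 2"
begin

lemma trace_add: "trace m (x + y) = trace m x + trace m (y::'a)"
  using char_2 by (simp add: trace_def freshmans_dream' sum.distrib)

lemma trace_sum: "trace m (sum f A) = (\<Sum>i\<in>A. trace m (f i :: 'a))"
  using char_2 by (simp add: trace_def freshmans_dream_sum' sum.swap[of _ A])

lemma trace_one: "even m \<Longrightarrow> trace m (1::'a) = 0"
  by (simp add: trace_def of_nat_eq_0_iff_char_dvd char_2)

lemma trace_power_two_power_minus_one:
  "trace m ((x + 1) ^ (2 ^ k - 1)) = (\<Sum>i<2 ^ k. trace m (x ^ i :: 'a))"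
  by (simp only: power_two_power_minus_one_CHAR_2[OF char_2] trace_sum)

end

context
  fixes m :: nat
  assumes card: "card (UNIV :: 'a::{finite,field} set) = 2 ^ m"
begin

lemma trace_power2: "trace m (x\<^sup>2) = trace m (x::'a)"
proof -
  have "x + (\<Sum>i<m. x ^ 2 ^ Suc i) = (\<Sum>i<Suc m. x ^ 2 ^ i)"
    by (subst sum.lessThan_Suc_shift) simp
  also have "\<dots> = x + (\<Sum>i<m. x ^ 2 ^ i)"
    using power_card[of x] unfolding card by (simp add: add.commute)
  finally show ?thesis unfolding trace_def by (simp add: power_mult)
qed

lemma trace_power_two_power: "trace m (x ^ 2 ^ k) = trace m (x::'a)"
  by (induction k) (simp_all add: power_mult trace_power2 mult.commute[of 2])

lemma trace_mult_half_conjugate: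
  assumes "m = 2 * h"
  shows "trace m (x * y ^ 2 ^ h) = trace m (x ^ 2 ^ h * (y::'a))"
proof -
  have "trace m (x * y ^ 2 ^ h) = trace m ((x * y ^ 2 ^ h) ^ 2 ^ h)"
    by (rule trace_power_two_power[symmetric])
  also have "(x * y ^ 2 ^ h) ^ 2 ^ h = x ^ 2 ^ h * y ^ 2 ^ m"
    by (simp add: assms mult_2 power_mult_distrib power_add flip: power_mult)
  also have "y ^ 2 ^ m = y" using power_card[of y] by (simp only: card)
  finally show ?thesis .
qed

lemma trace_f7_third_summand:
  fixes x :: 'a
  assumes m_eq: "m = 2 * h" and h_pos: "h \<ge> 1"
  shows "trace m ((x + 1) ^ (2 ^ m - 2 ^ (h + 1) + 2)) =
    (\<Sum>j<2 ^ (h - 1). trace m (x ^ j)) + (\<Sum>j<2 ^ (h - 1). trace m (x ^ (j + 2 ^ h)))"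
proof -
  note char_2 = CHAR_eq_2_if_card[OF card]
  obtain k where h_eq: "h = Suc k" using h_pos by (cases h) auto
  have "(2::nat) ^ m = 2 ^ h * 2 ^ h" by (simp add: m_eq mult_2 power_add)
  then have "2 ^ m - 2 ^ (h + 1) + 2 = (1 + (2 ^ (h - 1) - 1) * 2 ^ h) * (2::nat)"
    by (simp add: h_eq algebra_simps)
  then have "trace m ((x + 1) ^ (2 ^ m - 2 ^ (h + 1) + 2)) =
      trace m ((x + 1) ^ (1 + (2 ^ (h - 1) - 1) * 2 ^ h))"
    by (simp only: power_mult trace_power2)
  also have "\<dots> = trace m ((x + 1) * ((x + 1) ^ (2 ^ (h - 1) - 1)) ^ 2 ^ h)"
    by (simp only: power_add power_mult power_one_right)
  also have "\<dots> = trace m ((x ^ 2 ^ h + 1) * (\<Sum>j<2 ^ (h - 1). x ^ j))"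
    unfolding trace_mult_half_conjugate[OF m_eq] power_two_power_minus_one_CHAR_2[OF char_2]
    using char_2 by (simp add: freshmans_dream')
  also have "(x ^ 2 ^ h + 1) * (\<Sum>j<2 ^ (h - 1). x ^ j) =
      (\<Sum>j<2 ^ (h - 1). x ^ j) + (\<Sum>j<2 ^ (h - 1). x ^ (j + 2 ^ h))"
    by (simp add: algebra_simps power_add sum_distrib_left sum.distrib)
  finally show ?thesis by (simp only: trace_add[OF char_2] trace_sum[OF char_2])
qed

end

context
  fixes T :: "nat \<Rightarrow> 'b::comm_monoid_add"
  assumes T_double: "\<And>n. T (2 * n) = T n"
begin

lemma sum_halve:
  "sum T {2 * a..<2 * b} = sum T {a..<b} + sum T {i \<in> {2 * a..<2 * b}. odd i}"
proof -
  have "{2 * a..<2 * b} = (\<lambda>n. 2 * n) ` {a..<b} \<union> {i \<in> {2 * a..<2 * b}. odd i}"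
    by (auto elim!: evenE)
  then have "sum T {2 * a..<2 * b} =
      sum T ((\<lambda>n. 2 * n) ` {a..<b} \<union> {i \<in> {2 * a..<2 * b}. odd i})" by (rule arg_cong)
  also have "\<dots> = sum T ((\<lambda>n. 2 * n) ` {a..<b}) + sum T {i \<in> {2 * a..<2 * b}. odd i}"
    by (rule sum.union_disjoint) auto
  also have "sum T ((\<lambda>n. 2 * n) ` {a..<b}) = sum T {a..<b}"
    by (subst sum.reindex) (auto simp: inj_on_def T_double)
  finally show ?thesis .
qed

lemma sum_leading_bits_10:
  "sum T {2 * 2 ^ k..<3 * 2 ^ k} = T 1 + (\<Sum>j\<in>{1..k}. \<Sum>i\<in>Gamma j. T (i + 2 ^ (j + 1)))"
proof (induction k)
  case 0
  have "{2 * 2 ^ 0..<3 * 2 ^ 0} = {2::nat}" by auto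
  then show ?case using T_double[of 1] by simp
next
  case (Suc k)
  have "sum T {2 * (2 * 2 ^ k)..<2 * (3 * 2 ^ k)} =
      sum T {2 * 2 ^ k..<3 * 2 ^ k} + sum T {i \<in> {2 * (2 * 2 ^ k)..<2 * (3 * 2 ^ k)}. odd i}"
    by (rule sum_halve)
  also have "sum T {i \<in> {2 * (2 * 2 ^ k)..<2 * (3 * 2 ^ k)}. odd i} =
      (\<Sum>i\<in>Gamma (Suc k). T (i + 2 ^ (Suc k + 1)))"
    by (rule sum.reindex_bij_witness[of _ "\<lambda>i. i + 2 ^ (Suc k + 1)" "\<lambda>i. i - 2 ^ (Suc k + 1)"])
      (auto simp: Gamma_iff)
  finally show ?case unfolding Suc by (simp add: add.assoc mult.left_commute)
qed

lemma sum_leading_bits_11: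
  "sum T {3 * 2 ^ Suc k..<4 * 2 ^ Suc k} = sum T {3 * 2 ^ k..<4 * 2 ^ k} +
    (\<Sum>i\<in>Gamma (k + 2) - Gamma (k + 1). T (i + 2 ^ (k + 2)))"
proof -
  have "sum T {2 * (3 * 2 ^ k)..<2 * (4 * 2 ^ k)} =
      sum T {3 * 2 ^ k..<4 * 2 ^ k} + sum T {i \<in> {2 * (3 * 2 ^ k)..<2 * (4 * 2 ^ k)}. odd i}"
    by (rule sum_halve)
  also have "sum T {i \<in> {2 * (3 * 2 ^ k)..<2 * (4 * 2 ^ k)}. odd i} =
      (\<Sum>i\<in>Gamma (k + 2) - Gamma (k + 1). T (i + 2 ^ (k + 2)))"
    by (rule sum.reindex_bij_witness[of _ "\<lambda>i. i + 2 ^ (k + 2)" "\<lambda>i. i - 2 ^ (k + 2)"])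
      (auto simp: Gamma_iff)
  finally show ?thesis by (simp add: mult.left_commute)
qed

end

lemma sum_coset_leaders:
  fixes T :: "nat \<Rightarrow> 'a::ring_1"
  assumes char_2: "CHAR('a) = 2" and T_double: "\<And>n. T (2 * n) = T n" and "h \<ge> 2"
  shows "sum T (coset_leaders h) = T 1 + (\<Sum>i<2 ^ (h + 1). T i) +
    ((\<Sum>j<2 ^ (h - 1). T j) + (\<Sum>j<2 ^ (h - 1). T (j + 2 ^ h)))"
proof -
  obtain k where h_eq: "h = Suc (Suc k)" using \<open>h \<ge> 2\<close> by (metis add_2_eq_Suc le_Suc_ex)
  define q :: nat where "q = 2 ^ k"
  have powers: "(2::nat) ^ h = 4 * q" "(2::nat) ^ (h + 1) = 8 * q" "(2::nat) ^ (h - 1) = 2 * q"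
    by (simp_all add: h_eq q_def)
  have cancel: "u + (u + w) = w" for u w :: 'a
    using minus_CHAR_2[OF char_2, of u u] by (simp flip: add.assoc)
  have split: "(\<Sum>i<8 * q. T i) = sum T {..<2 * q} + (sum T {2 * q..<3 * q} +
      sum T {3 * q..<4 * q} + sum T {4 * q..<6 * q} + sum T {6 * q..<8 * q})"
    by (simp add: sum.atLeastLessThan_concat lessThan_atLeast0 add.assoc)
  have shift: "(\<Sum>j<2 * q. T (j + 4 * q)) = sum T {4 * q..<6 * q}"
    using sum.shift_bounds_nat_ivl[of T 0 "4 * q" "2 * q"] by (simp add: lessThan_atLeast0)
  have bits_10: "sum T {2 * q..<3 * q} = T 1 + (\<Sum>j\<in>{1..k}. \<Sum>i\<in>Gamma j. T (i + 2 ^ (j + 1)))"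
    unfolding q_def by (rule sum_leading_bits_10) (rule T_double)
  have bits_11: "sum T {6 * q..<8 * q} = sum T {3 * q..<4 * q} +
      (\<Sum>i\<in>Gamma h - Gamma (h - 1). T (i + 2 ^ h))"
    using sum_leading_bits_11[of T k, OF T_double] by (simp add: q_def h_eq)
  have "T 1 + (\<Sum>i<8 * q. T i) + (sum T {..<2 * q} + sum T {4 * q..<6 * q}) =
      (\<Sum>i\<in>Gamma h - Gamma (h - 1). T (i + 2 ^ h)) +
      (\<Sum>j\<in>{1..k}. \<Sum>i\<in>Gamma j. T (i + 2 ^ (j + 1)))"
    unfolding split bits_10 bits_11 by (simp only: add_ac cancel)
  also have "\<dots> = sum T (coset_leaders h)"
    unfolding sum.coset_leaders_split by (simp add: h_eq)
  finally show ?thesis unfolding powers shift by simp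
qed

lemma trace_f7_shift:
  fixes x :: "'a::{finite,field}"
  assumes card: "card (UNIV :: 'a set) = 2 ^ m" and m_eq: "m = 2 * h" and "h \<ge> 2"
  shows "trace m (f7 m (x + 1)) = (\<Sum>e\<in>coset_leaders h. trace m (x ^ e))"
proof -
  note char_2 = CHAR_eq_2_if_card[OF card]
  have "f7 m (x + 1) = (x + 1) + (x + 1) ^ (2 ^ (h + 1) - 1) + (x + 1) ^ (2 ^ m - 2 ^ (h + 1) + 2)"
    by (simp add: f7_def m_eq)
  then have "trace m (f7 m (x + 1)) =
      trace m (x ^ 1) + (\<Sum>i<2 ^ (h + 1). trace m (x ^ i)) +
      ((\<Sum>j<2 ^ (h - 1). trace m (x ^ j)) + (\<Sum>j<2 ^ (h - 1). trace m (x ^ (j + 2 ^ h))))"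
    using trace_one[OF char_2] trace_f7_third_summand[OF card m_eq] \<open>h \<ge> 2\<close>
    by (simp only: trace_add[OF char_2] trace_power_two_power_minus_one[OF char_2])
      (simp add: m_eq)
  also have "\<dots> = (\<Sum>e\<in>coset_leaders h. trace m (x ^ e))"
  proof (rule sum_coset_leaders[symmetric, OF char_2 _ \<open>h \<ge> 2\<close>])
    show "trace m (x ^ (2 * n)) = trace m (x ^ n)" for n
      using trace_power2[OF card, of "x ^ n"] by (simp add: mult.commute flip: power_mult)
  qed
  finally show ?thesis .
qed

subsection \<open>The zeros of the code\<close>

definition code_zeros :: "'a::monoid_mult \<Rightarrow> nat \<Rightarrow> 'a set" where
  "code_zeros \<beta> h = (\<Union>e\<in>coset_leaders h. conjugates (\<beta> ^ e))"

context
  fixes \<beta> :: "'a::{finite,field}" and h :: nat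
  assumes card: "card (UNIV :: 'a set) = 2 ^ (2 * h)"
    and primitive: "primitive \<beta>" and h_ge_2: "h \<ge> 2"
begin

lemma coset_leader_conjugates_inj:
  assumes "e \<in> coset_leaders h" "e' \<in> coset_leaders h" "k < 2 * h" "k' < 2 * h"
    and "(\<beta> ^ e) ^ 2 ^ k = (\<beta> ^ e') ^ 2 ^ k'"
  shows "e = e' \<and> k = k'"
  using assms primitive_power_eq_iff_cong[OF primitive] card
  by (intro coset_leaders_cong_imp_eq[OF h_ge_2]) (auto simp flip: power_mult)

lemma disjoint_conjugates_coset_leaders:
  "disjoint_family_on (\<lambda>e. conjugates (\<beta> ^ e)) (coset_leaders h)"
  unfolding disjoint_family_on_def conjugates_eq_image[OF card]
  using coset_leader_conjugates_inj by blast

lemma card_conjugates_coset_leader: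
  assumes "e \<in> coset_leaders h"
  shows "card (conjugates (\<beta> ^ e)) = 2 * h"
proof -
  have "inj_on (\<lambda>k. (\<beta> ^ e) ^ 2 ^ k) {..<2 * h}"
    using coset_leader_conjugates_inj assms by (auto simp: inj_on_def)
  then show ?thesis unfolding conjugates_eq_image[OF card] by (simp add: card_image)
qed

lemma root_poly_code_zeros:
  "root_poly (code_zeros \<beta> h) = (\<Prod>e\<in>coset_leaders h. min_poly_F2 (\<beta> ^ e))"
  unfolding code_zeros_def
  by (simp add: root_poly_UNION finite_coset_leaders disjoint_conjugates_coset_leaders
      min_poly_F2_eq_root_poly CHAR_eq_2_if_card[OF card])

lemma card_code_zeros: "card (code_zeros \<beta> h) = 2 * h * (2 ^ (h - 1) - 1)"
proof -
  have "card (code_zeros \<beta> h) = (\<Sum>e\<in>coset_leaders h. card (conjugates (\<beta> ^ e)))"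
    unfolding code_zeros_def using disjoint_conjugates_coset_leaders
    by (intro card_UN_disjoint) (auto simp: finite_coset_leaders disjoint_family_on_def)
  then show ?thesis by (simp add: card_conjugates_coset_leader card_coset_leaders h_ge_2)
qed

lemma card_code_zeros_less: "card (code_zeros \<beta> h) < 2 ^ (2 * h) - 1"
proof -
  have "2 * (2 ^ (h - 1) - 1) = 2 ^ h - (2::nat)" using h_ge_2 by (cases h) simp_all
  then have "card (code_zeros \<beta> h) = h * (2 ^ h - 2)" by (simp add: card_code_zeros)
  also have "\<dots> \<le> 2 ^ h * (2 ^ h - 2)" by (intro mult_right_mono) (auto intro: less_imp_le)
  also have "\<dots> < 2 ^ h * 2 ^ h - 1"
  proof -
    have "(2::nat) ^ 2 \<le> 2 ^ h" using h_ge_2 by (intro power_increasing) auto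
    from this mult_le_mono[OF this this] show ?thesis by (simp add: right_diff_distrib')
  qed
  finally show ?thesis by (simp add: mult_2 power_add)
qed

lemma cyclic_generator_code_zeros: "cyclic_generator (2 ^ (2 * h) - 1) (root_poly (code_zeros \<beta> h))"
proof
  show "CHAR('a) = 2" by (rule CHAR_eq_2_if_card[OF card])
  then show "binary_poly (root_poly (code_zeros \<beta> h))"
    unfolding code_zeros_def by (rule binary_root_poly_UN_conjugates) simp
  have "\<beta> \<noteq> 0" using primitive by (simp add: primitive_def)
  then have "0 \<notin> code_zeros \<beta> h" by (auto simp: code_zeros_def zero_notin_conjugates)
  then show "root_poly (code_zeros \<beta> h) dvd monom 1 (2 ^ (2 * h) - 1) - 1"
    unfolding card[symmetric] by (rule root_poly_dvd_monom_minus_one)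
  show "(0::nat) < 2 ^ (2 * h) - 1" using card_code_zeros_less by linarith
qed

lemma arith_progression_in_code_zeros:
  assumes "j < 2 ^ (h - 2)"
  shows "\<beta> ^ (3 * 2 ^ (h - 1) + 1) * (\<beta>\<^sup>2) ^ j \<in> code_zeros \<beta> h"
proof -
  have "\<beta> ^ (3 * 2 ^ (h - 1) + 1 + 2 * j) \<in> code_zeros \<beta> h"
    unfolding code_zeros_def
    using arith_progression_in_coset_leaders[OF h_ge_2 assms] self_in_conjugates by blast
  then show ?thesis
    by (simp only: power_add[of \<beta> "3 * 2 ^ (h - 1) + 1" "2 * j"] power_mult[of \<beta> 2 j])
qed

lemma min_dist_code_zeros_ge:
  "2 ^ (h - 2) + 1 \<le>
    min_dist (2 ^ (2 * h) - 1) (cyclic_code (2 ^ (2 * h) - 1) (root_poly (code_zeros \<beta> h)))"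
proof (rule cyclic_generator.BCH_bound[OF cyclic_generator_code_zeros])
  show "degree (root_poly (code_zeros \<beta> h)) < 2 ^ (2 * h) - 1"
    using card_code_zeros_less by (simp add: degree_root_poly)
  have "coprime 2 (2 ^ (2 * h) - 1 :: nat)" using h_ge_2 by simp
  then show "inj_on (\<lambda>i. (\<beta>\<^sup>2) ^ i) {..<2 ^ (2 * h) - 1}"
    using primitive_power_eq_iff_cong[OF primitive] card
    by (auto simp: inj_on_def cong_mult_lcancel_nat simp flip: power_mult
        intro: cong_less_modulus_unique_nat)
  show "\<beta> ^ (3 * 2 ^ (h - 1) + 1) \<noteq> 0" using primitive by (simp add: primitive_def)
qed (simp only: poly_root_poly_eq_0_iff[OF finite] arith_progression_in_code_zeros)

lemma seq_min_poly_trace_f7: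
  assumes m_eq: "m = 2 * h" and s_eq: "\<And>t. s t = trace m (f7 m (inverse \<beta> ^ t + 1))"
  shows "seq_min_poly s = root_poly (code_zeros \<beta> h)"
  unfolding code_zeros_def
proof (rule seq_min_poly_sum_trace[OF card finite_coset_leaders _ disjoint_conjugates_coset_leaders])
  show "s t = (\<Sum>e\<in>coset_leaders h. trace (2 * h) (inverse (\<beta> ^ e) ^ t))" for t
    using trace_f7_shift[OF card refl h_ge_2]
    by (simp add: s_eq m_eq power_inverse mult.commute flip: power_mult)
qed (use card_conjugates_coset_leader primitive in \<open>simp_all add: primitive_def\<close>)

end

theorem theorem7:
  fixes \<alpha> :: "'a::{finite,field}" and m h :: nat and s :: "nat \<Rightarrow> 'a"
  assumes "card (UNIV :: 'a set) = 2 ^ m"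
    and "m \<ge> 6" and "even m" and "h = m div 2"
    and "primitive \<alpha>"
    and "\<And>t. s t = trace m (f7 m (\<alpha> ^ t + 1))"
  shows "(seq_min_poly s =
           (\<Prod>i\<in>Gamma h - Gamma (h - 1). min_poly_F2 (inverse \<alpha> ^ (i + 2 ^ h))) *
           (\<Prod>j\<in>{1..h - 2}. \<Prod>i\<in>Gamma j. min_poly_F2 (inverse \<alpha> ^ (i + 2 ^ (j + 1))))) \<and>
    linear_span s = m * (2 ^ ((m - 2) div 2) - 1) \<and>
    card (cyclic_code (2 ^ m - 1) (seq_min_poly s)) = 2 ^ (2 ^ m - 1 - m * (2 ^ ((m - 2) div 2) - 1)) \<and>
    2 ^ ((m - 4) div 2) + 1 \<le> min_dist (2 ^ m - 1) (cyclic_code (2 ^ m - 1) (seq_min_poly s)) \<and>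
    min_dist (2 ^ m - 1) (cyclic_code (2 ^ m - 1) (seq_min_poly s)) \<le> 1 + m * (2 ^ ((m - 2) div 2) - 1)"
proof -
  have m_eq: "m = 2 * h" and h_ge_2: "h \<ge> 2"
    and exponents: "(m - 2) div 2 = h - 1" "(m - 4) div 2 = h - 2"
    using assms(2-4) by auto
  let ?R = "code_zeros (inverse \<alpha>) h"
  note code = assms(1)[unfolded m_eq] primitive_inverse[OF assms(5)] h_ge_2
  interpret cyclic_generator "2 ^ (2 * h) - 1" "root_poly ?R"
    by (rule cyclic_generator_code_zeros[OF code])
  have min_poly: "seq_min_poly s = root_poly ?R"
    using assms(6) by (intro seq_min_poly_trace_f7[OF code m_eq]) simp
  have degree: "degree (root_poly ?R) = m * (2 ^ (h - 1) - 1)"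
    by (simp add: degree_root_poly card_code_zeros[OF code] m_eq)
  have less: "degree (root_poly ?R) < 2 ^ (2 * h) - 1"
    using card_code_zeros_less[OF code] by (simp add: degree_root_poly)
  show ?thesis
    unfolding linear_span_def min_poly exponents
    using root_poly_code_zeros[OF code, unfolded prod.coset_leaders_split]
      degree card_cyclic_code min_dist_code_zeros_ge[OF code] min_dist_cyclic_code_le[OF less]
    by (simp only: m_eq)
qed

end
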